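(* Assume $\mathcal K$ is a transitive projective Fraïssé class with projective Fraïssé limit $\mathbb K$ and canonical quotient $K=\mathbb K/R^{\mathbb K}$. (i) For each $k\in\mathbb N$, $\mathcal U^{(k)}$ is a uniformity on ${\rm Aut}(\mathbb K)$. (ii) $\mathcal U^{(0)}$ equals the uniformity on ${\rm Aut}(\mathbb K)$ induced by the uniform (supremum) metric $(\sigma,\tau)\mapsto\sup_{x\in\mathbb K}\rho(\sigma(x),\tau(x))$, where $\rho$ is a compatible metric on $\mathbb K$. (iii) For each $k\geq1$, $\mathcal U^{(k)}$ equals the uniformity on ${\rm Aut}(\mathbb K)$ induced by the pseudometric $d(\sigma,\tau)=\sup_{x\in K}d^0({\rm pr}(\sigma)(x),{\rm pr}(\tau)(x))$, where $d^0$ is a fixed compatible metric on $K$.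
   Context: Reflexive graph: set with reflexive symmetric relation $R$; strong homomorphism $f:X\to Y$: preserves $R$ and every $R$-related pair in $Y$ is the image of an $R$-related pair in $X$. For $k\ge1$, $aR^kb$ iff there is a chain $a=c_0Rc_1\cdots Rc_k=b$; $R^0$ is equality; for maps $\alpha,\beta$ from a set $Z$, $\alpha R^k\beta$ means $\alpha(z)R^k\beta(z)$ for all $z$. $\mathcal K$: countable category of finite reflexive graphs with morphisms ${\rm Epi}(A,B)$ being strong homomorphisms, satisfying (o) [if $f\in{\rm Epi}(A,B)$, $h\in{\rm Epi}(A,C)$, $g:B\to C$, $h=g\circ f$, then $g\in{\rm Epi}(B,C)$], joint projection and projective amalgamation. $\mathbb K=\varprojlim(A_n,\pi_n)$ for a generic sequence ($A_n\in\mathcal K$, $\pi_n\in{\rm Epi}(A_{n+1},A_n)$; every $A\in\mathcal K$ receives a morphism from some $A_m$; for every $f\in{\rm Epi}(A,A_m)$ there are $n>m$, $g\in{\rm Epi}(A_n,A)$ with $f\circ g=\pi_m\circ\cdots\circ\pi_{n-1}$), ${\rm Epi}(\mathbb K,A)=\{f\circ\pi^\infty_n:f\in{\rm Epi}(A_n,A)\}$, ${\rm Epi}_{\mathbb K}=\bigcup_A{\rm Epi}(\mathbb K,A)$. $xR^{\mathbb K}y$ iff $\varphi(x)R\varphi(y)$ for all $\varphi\in{\rm Epi}_{\mathbb K}$; transitivity of $\mathcal K$ means $R^{\mathbb K}$ is transitive, so it is a closed equivalence relation and $K=\mathbb K/R^{\mathbb K}$ is a compact metrizable space with quotient map ${\rm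 pr}$. ${\rm Aut}(\mathbb K)$: homeomorphisms $\sigma$ of $\mathbb K$ with $\varphi\circ\sigma,\varphi\circ\sigma^{-1}\in{\rm Epi}_{\mathbb K}$ for all $\varphi\in{\rm Epi}_{\mathbb K}$; each $\sigma$ induces ${\rm pr}(\sigma)\in{\rm Homeo}(K)$ by ${\rm pr}(\sigma)({\rm pr}(x))={\rm pr}(\sigma(x))$. For $\phi\in{\rm Epi}_{\mathbb K}$ and $k\in\mathbb N$: $U^{(k)}_\phi=\{(f,g)\in{\rm Aut}(\mathbb K)^2:\phi\circ f\,R^k\,\phi\circ g\}$ (so $U^{(0)}_\phi$ is given by $\phi\circ f=\phi\circ g$), and $\mathcal U^{(k)}$ is the family of all subsets of ${\rm Aut}(\mathbb K)^2$ containing some $U^{(k)}_\phi$. A uniformity on $X$ is a family $\mathcal U$ of subsets of $X\times X$, each containing the diagonal, closed under supersets and inverses, and such that for each $V\in\mathcal U$ there is $U\in\mathcal U$ with $U\circ U\subseteq V$. The uniformity induced by a pseudometric $\rho$ consists of all sets containing some $\{(x,y):\rho(x,y)<r\}$, $r>0$. *)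

theory Defs
  imports "HOL-Analysis.Analysis"
begin

section \<open>Categories of finite reflexive graphs\<close>

record 'v rgraph =
  verts :: "'v set"
  adj :: "'v rel"

definition finite_reflexive_graph :: "'v rgraph \<Rightarrow> bool" where
  "finite_reflexive_graph G \<longleftrightarrow>
     finite (verts G) \<and> adj G \<subseteq> verts G \<times> verts G \<and> refl_on (verts G) (adj G) \<and> sym (adj G)"

text \<open>All maps between carrier sets are extensional functions (value \<open>undefined\<close> outside
  the domain), so that equality of maps is equality of HOL functions; \<open>compose\<close> is
  composition restricted to the domain.\<close>

definition strong_hom :: "'v rgraph \<Rightarrow> 'v rgraph \<Rightarrow> ('v \<Rightarrow> 'v) \<Rightarrow> bool" where
  "strong_hom G H f \<longleftrightarrow>
     f \<in> verts G \<rightarrow>\<^sub>E verts H \<and>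
     (\<forall>(x, y) \<in> adj G. (f x, f y) \<in> adj H) \<and>
     (\<forall>(a, b) \<in> adj H. \<exists>(x, y) \<in> adj G. f x = a \<and> f y = b)"

record 'v graph_category =
  Obj :: "'v rgraph set"
  Epi :: "'v rgraph \<Rightarrow> 'v rgraph \<Rightarrow> ('v \<Rightarrow> 'v) set"

definition is_graph_category :: "'v graph_category \<Rightarrow> bool" where
  "is_graph_category \<K> \<longleftrightarrow>
     (\<forall>A\<in>Obj \<K>. finite_reflexive_graph A) \<and>
     (\<forall>A\<in>Obj \<K>. \<forall>B\<in>Obj \<K>. \<forall>f\<in>Epi \<K> A B. strong_hom A B f) \<and>
     (\<forall>A\<in>Obj \<K>. (\<lambda>x\<in>verts A. x) \<in> Epi \<K> A A) \<and>
     (\<forall>A\<in>Obj \<K>. \<forall>B\<in>Obj \<K>. \<forall>C\<in>Obj \<K>. \<forall>f\<in>Epi \<K> A B. \<forall>g\<in>Epi \<K> B C.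
        compose (verts A) g f \<in> Epi \<K> A C)"

definition right_factor_closed :: "'v graph_category \<Rightarrow> bool" where
  "right_factor_closed \<K> \<longleftrightarrow>
     (\<forall>A\<in>Obj \<K>. \<forall>B\<in>Obj \<K>. \<forall>C\<in>Obj \<K>. \<forall>f\<in>Epi \<K> A B. \<forall>h\<in>Epi \<K> A C.
        \<forall>g \<in> verts B \<rightarrow>\<^sub>E verts C. h = compose (verts A) g f \<longrightarrow> g \<in> Epi \<K> B C)"

definition joint_projection :: "'v graph_category \<Rightarrow> bool" where
  "joint_projection \<K> \<longleftrightarrow>
     (\<forall>A\<in>Obj \<K>. \<forall>B\<in>Obj \<K>. \<exists>C\<in>Obj \<K>. Epi \<K> C A \<noteq> {} \<and> Epi \<K> C B \<noteq> {})"

definition projective_amalgamation :: "'v graph_category \<Rightarrow> bool" where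
  "projective_amalgamation \<K> \<longleftrightarrow>
     (\<forall>A\<in>Obj \<K>. \<forall>B\<in>Obj \<K>. \<forall>C\<in>Obj \<K>. \<forall>f\<in>Epi \<K> B A. \<forall>g\<in>Epi \<K> C A.
        \<exists>D\<in>Obj \<K>. \<exists>f'\<in>Epi \<K> D B. \<exists>g'\<in>Epi \<K> D C.
          compose (verts D) f f' = compose (verts D) g g')"

definition projective_Fraisse_class :: "'v graph_category \<Rightarrow> bool" where
  "projective_Fraisse_class \<K> \<longleftrightarrow>
     is_graph_category \<K> \<and> countable (Obj \<K>) \<and> right_factor_closed \<K> \<and>
     joint_projection \<K> \<and> projective_amalgamation \<K>"

section \<open>Generic sequences and the projective limit\<close>

text \<open>\<open>bonding A p m k\<close> is the composite of \<open>p m, \<dots>, p (m + k - 1)\<close>, from \<open>A (m + k)\<close> to \<open>A m\<close>.\<close>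

primrec bonding :: "(nat \<Rightarrow> 'v rgraph) \<Rightarrow> (nat \<Rightarrow> 'v \<Rightarrow> 'v) \<Rightarrow> nat \<Rightarrow> nat \<Rightarrow> 'v \<Rightarrow> 'v" where
  "bonding A p m 0 = (\<lambda>x\<in>verts (A m). x)"
| "bonding A p m (Suc k) = compose (verts (A (m + Suc k))) (bonding A p m k) (p (m + k))"

definition generic_sequence ::
    "'v graph_category \<Rightarrow> (nat \<Rightarrow> 'v rgraph) \<Rightarrow> (nat \<Rightarrow> 'v \<Rightarrow> 'v) \<Rightarrow> bool" where
  "generic_sequence \<K> A p \<longleftrightarrow>
     (\<forall>n. A n \<in> Obj \<K>) \<and>
     (\<forall>n. p n \<in> Epi \<K> (A (Suc n)) (A n)) \<and>
     (\<forall>B\<in>Obj \<K>. \<exists>m. Epi \<K> (A m) B \<noteq> {}) \<and>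
     (\<forall>m. \<forall>B\<in>Obj \<K>. \<forall>f\<in>Epi \<K> B (A m). \<exists>n>m. \<exists>g\<in>Epi \<K> (A n) B.
        compose (verts (A n)) f g = bonding A p m (n - m))"

definition PLim :: "(nat \<Rightarrow> 'v rgraph) \<Rightarrow> (nat \<Rightarrow> 'v \<Rightarrow> 'v) \<Rightarrow> (nat \<Rightarrow> 'v) set" where
  "PLim A p = {x. \<forall>n. x n \<in> verts (A n) \<and> p n (x (Suc n)) = x n}"

definition PLim_topology :: "(nat \<Rightarrow> 'v rgraph) \<Rightarrow> (nat \<Rightarrow> 'v \<Rightarrow> 'v) \<Rightarrow> (nat \<Rightarrow> 'v) topology" where
  "PLim_topology A p =
     subtopology (product_topology (\<lambda>n. discrete_topology (verts (A n))) UNIV) (PLim A p)"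

definition PLim_Epi ::
    "'v graph_category \<Rightarrow> (nat \<Rightarrow> 'v rgraph) \<Rightarrow> (nat \<Rightarrow> 'v \<Rightarrow> 'v) \<Rightarrow> 'v rgraph \<Rightarrow> ((nat \<Rightarrow> 'v) \<Rightarrow> 'v) set" where
  "PLim_Epi \<K> A p B = {compose (PLim A p) f (\<lambda>x. x n) | f n. f \<in> Epi \<K> (A n) B}"

text \<open>A map in the union of all \<open>PLim_Epi \<K> A p B\<close> carries its target graph \<open>B\<close> with it: two
  objects may have the same vertex set but different relations, so quantification over the
  union is quantification over \<open>B\<close> and \<open>\<phi>\<close>.\<close>

definition PLim_rel ::
    "'v graph_category \<Rightarrow> (nat \<Rightarrow> 'v rgraph) \<Rightarrow> (nat \<Rightarrow> 'v \<Rightarrow> 'v) \<Rightarrow> (nat \<Rightarrow> 'v) rel" where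
  "PLim_rel \<K> A p = {(x, y). x \<in> PLim A p \<and> y \<in> PLim A p \<and>
     (\<forall>B\<in>Obj \<K>. \<forall>\<phi>\<in>PLim_Epi \<K> A p B. (\<phi> x, \<phi> y) \<in> adj B)}"

section \<open>The canonical quotient\<close>

definition quot ::
    "'v graph_category \<Rightarrow> (nat \<Rightarrow> 'v rgraph) \<Rightarrow> (nat \<Rightarrow> 'v \<Rightarrow> 'v) \<Rightarrow> (nat \<Rightarrow> 'v) set set" where
  "quot \<K> A p = PLim A p // PLim_rel \<K> A p"

definition pr ::
    "'v graph_category \<Rightarrow> (nat \<Rightarrow> 'v rgraph) \<Rightarrow> (nat \<Rightarrow> 'v \<Rightarrow> 'v) \<Rightarrow> (nat \<Rightarrow> 'v) \<Rightarrow> (nat \<Rightarrow> 'v) set" where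
  "pr \<K> A p x = PLim_rel \<K> A p `` {x}"

definition quot_topology ::
    "'v graph_category \<Rightarrow> (nat \<Rightarrow> 'v rgraph) \<Rightarrow> (nat \<Rightarrow> 'v \<Rightarrow> 'v) \<Rightarrow> (nat \<Rightarrow> 'v) set topology" where
  "quot_topology \<K> A p = topology (\<lambda>U. U \<subseteq> quot \<K> A p \<and>
     openin (PLim_topology A p) {x \<in> PLim A p. pr \<K> A p x \<in> U})"

definition Aut ::
    "'v graph_category \<Rightarrow> (nat \<Rightarrow> 'v rgraph) \<Rightarrow> (nat \<Rightarrow> 'v \<Rightarrow> 'v) \<Rightarrow> ((nat \<Rightarrow> 'v) \<Rightarrow> (nat \<Rightarrow> 'v)) set" where
  "Aut \<K> A p = {\<sigma>. \<sigma> \<in> extensional (PLim A p) \<and>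
     homeomorphic_map (PLim_topology A p) (PLim_topology A p) \<sigma> \<and>
     (\<forall>B\<in>Obj \<K>. \<forall>\<phi>\<in>PLim_Epi \<K> A p B.
        compose (PLim A p) \<phi> \<sigma> \<in> PLim_Epi \<K> A p B \<and>
        compose (PLim A p) \<phi> (inv_into (PLim A p) \<sigma>) \<in> PLim_Epi \<K> A p B)}"

text \<open>The homeomorphism of the quotient induced by an automorphism; its defining equation
  is \<open>pr_hom_pr\<close> below.\<close>

definition pr_hom ::
    "'v graph_category \<Rightarrow> (nat \<Rightarrow> 'v rgraph) \<Rightarrow> (nat \<Rightarrow> 'v \<Rightarrow> 'v) \<Rightarrow> ((nat \<Rightarrow> 'v) \<Rightarrow> (nat \<Rightarrow> 'v)) \<Rightarrow>
     (nat \<Rightarrow> 'v) set \<Rightarrow> (nat \<Rightarrow> 'v) set" where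
  "pr_hom \<K> A p \<sigma> c = the_elem ((\<lambda>x. pr \<K> A p (\<sigma> x)) ` c)"

section \<open>Uniformities\<close>

text \<open>Closure under finite intersections is not part of the definition used here.\<close>

definition is_uniformity :: "'a set \<Rightarrow> 'a rel set \<Rightarrow> bool" where
  "is_uniformity X \<U> \<longleftrightarrow>
     (\<forall>U\<in>\<U>. U \<subseteq> X \<times> X \<and> Id_on X \<subseteq> U) \<and>
     (\<forall>U\<in>\<U>. \<forall>W. U \<subseteq> W \<and> W \<subseteq> X \<times> X \<longrightarrow> W \<in> \<U>) \<and>
     (\<forall>U\<in>\<U>. U\<inverse> \<in> \<U>) \<and>
     (\<forall>V\<in>\<U>. \<exists>U\<in>\<U>. U O U \<subseteq> V)"

definition induced_uniformity :: "'a set \<Rightarrow> ('a \<Rightarrow> 'a \<Rightarrow> real) \<Rightarrow> 'a rel set" where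
  "induced_uniformity X d =
     {W. W \<subseteq> X \<times> X \<and> (\<exists>r>0. {(x, y). x \<in> X \<and> y \<in> X \<and> d x y < r} \<subseteq> W)}"

text \<open>\<open>d\<close> is a metric inducing the topology \<open>T\<close>.\<close>

definition compatible_metric :: "'a topology \<Rightarrow> ('a \<Rightarrow> 'a \<Rightarrow> real) \<Rightarrow> bool" where
  "compatible_metric T d \<longleftrightarrow>
     Metric_space (topspace T) d \<and> Metric_space.mtopology (topspace T) d = T"

text \<open>The supremum over the empty set, which HOL leaves unspecified for reals, is taken to be
  \<open>0\<close> (relevant only if all graphs are empty).\<close>

definition sup_dist :: "'a set \<Rightarrow> ('b \<Rightarrow> 'b \<Rightarrow> real) \<Rightarrow> ('a \<Rightarrow> 'b) \<Rightarrow> ('a \<Rightarrow> 'b) \<Rightarrow> real" where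
  "sup_dist S d f g = (if S = {} then 0 else SUP x\<in>S. d (f x) (g x))"

definition entourage ::
    "'v graph_category \<Rightarrow> (nat \<Rightarrow> 'v rgraph) \<Rightarrow> (nat \<Rightarrow> 'v \<Rightarrow> 'v) \<Rightarrow> nat \<Rightarrow> 'v rgraph \<Rightarrow>
     ((nat \<Rightarrow> 'v) \<Rightarrow> 'v) \<Rightarrow> ((nat \<Rightarrow> 'v) \<Rightarrow> (nat \<Rightarrow> 'v)) rel" where
  "entourage \<K> A p k B \<phi> = {(f, g). f \<in> Aut \<K> A p \<and> g \<in> Aut \<K> A p \<and>
     (\<forall>x\<in>PLim A p. (\<phi> (f x), \<phi> (g x)) \<in> adj B ^^ k)}"

definition Aut_uniformity ::
    "'v graph_category \<Rightarrow> (nat \<Rightarrow> 'v rgraph) \<Rightarrow> (nat \<Rightarrow> 'v \<Rightarrow> 'v) \<Rightarrow> nat \<Rightarrow>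
     ((nat \<Rightarrow> 'v) \<Rightarrow> (nat \<Rightarrow> 'v)) rel set" where
  "Aut_uniformity \<K> A p k = {W. W \<subseteq> Aut \<K> A p \<times> Aut \<K> A p \<and>
     (\<exists>B\<in>Obj \<K>. \<exists>\<phi>\<in>PLim_Epi \<K> A p B. entourage \<K> A p k B \<phi> \<subseteq> W)}"

section \<open>Adequacy of the quotient constructions\<close>

lemma topspace_Lim_topology [simp]: "topspace (PLim_topology A p) = PLim A p"
  by (auto simp: PLim_topology_def PLim_def)

lemma openin_quot_topology:
  "openin (quot_topology \<K> A p) U \<longleftrightarrow>
     U \<subseteq> quot \<K> A p \<and> openin (PLim_topology A p) {x \<in> PLim A p. pr \<K> A p x \<in> U}"
proof -
  have "istopology (\<lambda>U. U \<subseteq> quot \<K> A p \<and>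
     openin (PLim_topology A p) {x \<in> PLim A p. pr \<K> A p x \<in> U})"
    unfolding istopology_def
  proof (intro conjI allI impI)
    fix S T
    assume S: "S \<subseteq> quot \<K> A p \<and> openin (PLim_topology A p) {x \<in> PLim A p. pr \<K> A p x \<in> S}"
      and T: "T \<subseteq> quot \<K> A p \<and> openin (PLim_topology A p) {x \<in> PLim A p. pr \<K> A p x \<in> T}"
    show "S \<inter> T \<subseteq> quot \<K> A p" using S by blast
    have eq: "{x \<in> PLim A p. pr \<K> A p x \<in> S \<inter> T} =
        {x \<in> PLim A p. pr \<K> A p x \<in> S} \<inter> {x \<in> PLim A p. pr \<K> A p x \<in> T}" by blast
    show "openin (PLim_topology A p) {x \<in> PLim A p. pr \<K> A p x \<in> S \<inter> T}"
      unfolding eq using S T by (intro openin_Int) simp_all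
  next
    fix \<F>
    assume F: "\<forall>S\<in>\<F>. S \<subseteq> quot \<K> A p \<and> openin (PLim_topology A p) {x \<in> PLim A p. pr \<K> A p x \<in> S}"
    show "\<Union>\<F> \<subseteq> quot \<K> A p" using F by blast
    have eq: "{x \<in> PLim A p. pr \<K> A p x \<in> \<Union>\<F>} = \<Union>((\<lambda>S. {x \<in> PLim A p. pr \<K> A p x \<in> S}) ` \<F>)"
      by blast
    show "openin (PLim_topology A p) {x \<in> PLim A p. pr \<K> A p x \<in> \<Union>\<F>}"
      unfolding eq by (rule openin_Union) (use F in auto)
  qed
  then show ?thesis unfolding quot_topology_def by (simp add: topology_inverse')
qed

lemma topspace_quot_topology [simp]: "topspace (quot_topology \<K> A p) = quot \<K> A p"
proof -
  have "{x \<in> PLim A p. pr \<K> A p x \<in> quot \<K> A p} = topspace (PLim_topology A p)"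
    by (auto simp: quot_def pr_def intro: quotientI)
  then have "openin (quot_topology \<K> A p) (quot \<K> A p)"
    using openin_topspace[of "PLim_topology A p"] by (simp only: openin_quot_topology order_refl)
  moreover have "topspace (quot_topology \<K> A p) \<subseteq> quot \<K> A p"
    using openin_topspace[of "quot_topology \<K> A p"] by (simp only: openin_quot_topology)
  ultimately show ?thesis
    by (intro subset_antisym openin_subset)
qed

lemma quotient_map_pr: "quotient_map (PLim_topology A p) (quot_topology \<K> A p) (pr \<K> A p)"
proof -
  have "pr \<K> A p ` PLim A p = quot \<K> A p"
    unfolding quot_def pr_def quotient_def by blast
  then show ?thesis
    by (simp add: quotient_map_def openin_quot_topology)
qed

lemma equiv_PLim_rel:
  assumes "projective_Fraisse_class \<K>" "generic_sequence \<K> A p" "trans (PLim_rel \<K> A p)"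
  shows "equiv (PLim A p) (PLim_rel \<K> A p)"
proof -
  have g: "finite_reflexive_graph B" if "B \<in> Obj \<K>" for B
    using assms that by (auto simp: projective_Fraisse_class_def is_graph_category_def)
  have val: "\<phi> x \<in> verts B" if B: "B \<in> Obj \<K>" and \<phi>B: "\<phi> \<in> PLim_Epi \<K> A p B" and x: "x \<in> PLim A p" for B \<phi> x
  proof -
    obtain f n where f: "f \<in> Epi \<K> (A n) B" and \<phi>: "\<phi> = compose (PLim A p) f (\<lambda>x. x n)"
      using \<phi>B by (auto simp: PLim_Epi_def)
    have "A n \<in> Obj \<K>" using assms by (auto simp: generic_sequence_def)
    then have "strong_hom (A n) B f"
      using assms f B by (auto simp: projective_Fraisse_class_def is_graph_category_def)
    then show ?thesis
      using x by (auto simp: \<phi> strong_hom_def compose_def PLim_def)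
  qed
  have "refl_on (PLim A p) (PLim_rel \<K> A p)"
  proof (rule refl_onI)
    fix x assume x: "x \<in> PLim A p"
    have "(\<phi> x, \<phi> x) \<in> adj B" if "B \<in> Obj \<K>" "\<phi> \<in> PLim_Epi \<K> A p B" for B \<phi>
      using g[OF that(1)] val[OF that x] by (simp add: finite_reflexive_graph_def refl_on_def)
    then show "(x, x) \<in> PLim_rel \<K> A p" using x by (simp add: PLim_rel_def)
  qed
  moreover have "sym (PLim_rel \<K> A p)"
  proof (rule symI)
    fix x y assume xy: "(x, y) \<in> PLim_rel \<K> A p"
    have "(\<phi> y, \<phi> x) \<in> adj B" if "B \<in> Obj \<K>" "\<phi> \<in> PLim_Epi \<K> A p B" for B \<phi>
    proof -
      have "sym (adj B)" using g[OF that(1)] by (simp add: finite_reflexive_graph_def)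
      moreover have "(\<phi> x, \<phi> y) \<in> adj B" using xy that by (simp add: PLim_rel_def)
      ultimately show ?thesis by (rule symD)
    qed
    then show "(y, x) \<in> PLim_rel \<K> A p" using xy by (simp add: PLim_rel_def)
  qed
  moreover have "PLim_rel \<K> A p \<subseteq> PLim A p \<times> PLim A p"
    unfolding PLim_rel_def by blast
  ultimately show ?thesis
    using assms(3) by (intro equivI)
qed

lemma pr_hom_pr:
  assumes "projective_Fraisse_class \<K>" "generic_sequence \<K> A p" "trans (PLim_rel \<K> A p)"
    and \<sigma>: "\<sigma> \<in> Aut \<K> A p" and x: "x \<in> PLim A p"
  shows "pr_hom \<K> A p \<sigma> (pr \<K> A p x) = pr \<K> A p (\<sigma> x)"
proof -
  have e: "equiv (PLim A p) (PLim_rel \<K> A p)"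
    using assms by (intro equiv_PLim_rel)
  have im: "\<sigma> ` PLim A p = PLim A p"
    using \<sigma> homeomorphic_imp_surjective_map[of "PLim_topology A p" "PLim_topology A p" \<sigma>]
    by (simp add: Aut_def)
  have pres: "(\<sigma> x, \<sigma> y) \<in> PLim_rel \<K> A p" if "(x, y) \<in> PLim_rel \<K> A p" for y
  proof -
    have y: "y \<in> PLim A p" using that by (auto simp: PLim_rel_def)
    have "(\<phi> (\<sigma> x), \<phi> (\<sigma> y)) \<in> adj B" if "B \<in> Obj \<K>" "\<phi> \<in> PLim_Epi \<K> A p B" for B \<phi>
    proof -
      have "compose (PLim A p) \<phi> \<sigma> \<in> PLim_Epi \<K> A p B" using \<sigma> that by (auto simp: Aut_def)
      then have "(compose (PLim A p) \<phi> \<sigma> x, compose (PLim A p) \<phi> \<sigma> y) \<in> adj B"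
        using \<open>(x, y) \<in> PLim_rel \<K> A p\<close> that by (auto simp: PLim_rel_def)
      then show ?thesis using x y by (simp add: compose_def)
    qed
    then show ?thesis using im x y by (auto simp: PLim_rel_def)
  qed
  have "pr \<K> A p x \<noteq> {}"
    using equiv_class_self[OF e x] by (auto simp: pr_def)
  moreover have "pr \<K> A p (\<sigma> y) = pr \<K> A p (\<sigma> x)" if "y \<in> pr \<K> A p x" for y
  proof -
    have "(\<sigma> x, \<sigma> y) \<in> PLim_rel \<K> A p" using that by (intro pres) (simp add: pr_def)
    then show ?thesis unfolding pr_def by (rule equiv_class_eq[OF e, symmetric])
  qed
  ultimately show ?thesis unfolding pr_hom_def by (rule the_elem_image_unique)
qed

end

theory Submission
  imports Defs
begin

text \<open>
  Let \<open>E\<close>(\<open>k\<close>, \<open>n\<close>) be the set of pairs of threads whose \<open>n\<close>-th coordinates are joined by a chain of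
  length \<open>k\<close>. These sets are clopen and decrease with \<open>n\<close>. A chain in a single graph lifts
  to the limit, so by compactness the intersection over \<open>n\<close> of the \<open>E\<close>(\<open>k\<close>, \<open>n\<close>) is the \<open>k\<close>-fold
  power of the limit relation; by transitivity it is the limit relation itself when \<open>k \<ge> 1\<close>,
  and it is equality when \<open>k = 0\<close>. In both cases doubling \<open>k\<close> does not change it.
  By compactness every open neighbourhood of the intersection contains some \<open>E\<close>(\<open>k\<close>, \<open>n\<close>), and
  likewise some sublevel set of any continuous pseudometric vanishing exactly there.
  The first fact gives the composition axiom; together they compare the combinatorial
  entourages with the metric ones, the pseudometric being \<open>\<rho>\<close> on the limit when \<open>k = 0\<close> and the
  pullback of the metric of the quotient when \<open>k \<ge> 1\<close>.
\<close>

section \<open>Compactness and iterated relations\<close>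

text \<open>Otherwise the sets \<open>C n - U\<close> would be nonempty, closed and decreasing, so
  by compactness they would share a point; but \<open>sub\<close> leaves none.\<close>

lemma compact_space_nest_subset_open:
  assumes "compact_space X" and cl: "\<And>n. closedin X (C n)" and dec: "decseq C"
    and U: "openin X U" and sub: "(\<Inter>n. C n) \<subseteq> U"
  shows "\<exists>n::nat. C n \<subseteq> U"
proof (rule ccontr)
  assume "\<nexists>n. C n \<subseteq> U"
  then have "C n - U \<noteq> {}" for n by blast
  moreover have "closedin X (C n - U)" for n
    using cl U by (rule closedin_diff)
  moreover have "decseq (\<lambda>n. C n - U)"
    using dec by (auto simp: decseq_def)
  ultimately have "(\<Inter>n. C n - U) \<noteq> {}"
    by (intro compact_space_imp_nest[OF assms(1)]) auto
  then show False using sub by blast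
qed

lemma relpow_map:
  assumes "\<And>a b. (a, b) \<in> R \<Longrightarrow> (f a, f b) \<in> S"
  shows "(a, b) \<in> R ^^ k \<Longrightarrow> (f a, f b) \<in> S ^^ k"
proof (induction k arbitrary: b)
  case (Suc k)
  then show ?case using assms by (auto intro: relpow_Suc_I)
qed simp

lemma sym_relpow: "sym R \<Longrightarrow> sym (R ^^ k)"
proof (induction k)
  case (Suc k)
  then have "(R ^^ Suc k)\<inverse> = R O R ^^ k"
    by (simp add: converse_relcomp sym_conv_converse_eq)
  then show ?case
    by (simp add: sym_conv_converse_eq relpow_commute)
qed (simp add: sym_Id)

lemma refl_on_relpow:
  assumes "(a, a) \<in> R" shows "(a, a) \<in> R ^^ k"
  using assms by (induction k) auto

section \<open>Vertices of the graphs and threads through them\<close>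

locale transitive_limit =
  fixes \<K> :: "'v graph_category"
    and A :: "nat \<Rightarrow> 'v rgraph"
    and p :: "nat \<Rightarrow> 'v \<Rightarrow> 'v"
  assumes Fraisse: "projective_Fraisse_class \<K>"
    and generic: "generic_sequence \<K> A p"
    and transitive: "trans (PLim_rel \<K> A p)"
begin

abbreviation "T \<equiv> PLim_topology A p"

lemma obj_A: "A n \<in> Obj \<K>"
  using generic by (simp add: generic_sequence_def)

lemma obj_graph: "B \<in> Obj \<K> \<Longrightarrow> finite_reflexive_graph B"
  using Fraisse by (simp add: projective_Fraisse_class_def is_graph_category_def)

lemma Epi_strong_hom: "B \<in> Obj \<K> \<Longrightarrow> C \<in> Obj \<K> \<Longrightarrow> f \<in> Epi \<K> B C \<Longrightarrow> strong_hom B C f"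
  using Fraisse unfolding projective_Fraisse_class_def is_graph_category_def by blast

lemma p_hom: "strong_hom (A (Suc n)) (A n) (p n)"
  using generic by (intro Epi_strong_hom obj_A) (simp add: generic_sequence_def)

lemma strong_hom_adj: "strong_hom B C f \<Longrightarrow> (a, b) \<in> adj B \<Longrightarrow> (f a, f b) \<in> adj C"
  unfolding strong_hom_def by blast

lemma adj_refl: "B \<in> Obj \<K> \<Longrightarrow> a \<in> verts B \<Longrightarrow> (a, a) \<in> adj B"
  using obj_graph by (simp add: finite_reflexive_graph_def refl_on_def)

lemma adj_verts: "B \<in> Obj \<K> \<Longrightarrow> (a, b) \<in> adj B \<Longrightarrow> a \<in> verts B \<and> b \<in> verts B"
  using obj_graph unfolding finite_reflexive_graph_def by blast

lemma p_in: "a \<in> verts (A (Suc n)) \<Longrightarrow> p n a \<in> verts (A n)"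
  using p_hom[of n] by (auto simp: strong_hom_def)

text \<open>By reflexivity \<open>a\<close> carries a loop. A strong homomorphism lifts this loop to
  an edge, and an end of that edge is a preimage of \<open>a\<close>.\<close>

lemma p_surj:
  assumes "a \<in> verts (A n)" shows "\<exists>b\<in>verts (A (Suc n)). p n b = a"
proof -
  have "(a, a) \<in> adj (A n)" using assms by (intro adj_refl obj_A)
  then obtain x y where "(x, y) \<in> adj (A (Suc n))" "p n x = a"
    using p_hom[of n] unfolding strong_hom_def by blast
  then show ?thesis using adj_verts[OF obj_A] by blast
qed

lemma PLim_in: "x \<in> PLim A p \<Longrightarrow> x n \<in> verts (A n)"
  by (simp add: PLim_def)

lemma PLim_step: "x \<in> PLim A p \<Longrightarrow> p n (x (Suc n)) = x n"
  by (simp add: PLim_def)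

lemma partial_thread:
  "c \<in> verts (A n) \<Longrightarrow>
    \<exists>y. y n = c \<and> (\<forall>m\<le>n. y m \<in> verts (A m)) \<and> (\<forall>m<n. p m (y (Suc m)) = y m)"
proof (induction n arbitrary: c)
  case (Suc n)
  obtain y where "y n = p n c" "\<forall>m\<le>n. y m \<in> verts (A m)" "\<forall>m<n. p m (y (Suc m)) = y m"
    using Suc.IH[OF p_in[OF Suc.prems]] by blast
  then show ?case using Suc.prems
    by (intro exI[of _ "y(Suc n := c)"]) (auto simp: le_Suc_eq less_Suc_eq)
qed auto

text \<open>Below level \<open>n\<close> the coordinates are forced, being successive images of
  \<open>c\<close>. Above it, surjectivity of the bonding maps allows preimages to be chosen one
  after another.\<close>

lemma proj_surj:
  assumes c: "c \<in> verts (A n)"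
  shows "\<exists>x\<in>PLim A p. x n = c"
proof -
  obtain y where y: "y n = c" "\<forall>m\<le>n. y m \<in> verts (A m)" "\<forall>m<n. p m (y (Suc m)) = y m"
    using partial_thread[OF c] by blast
  \<comment> \<open>The value \<open>g i\<close> is the coordinate at level \<open>n + i\<close>;
    the clause for \<open>i = 0\<close> pins the starting point inside the dependent choice.\<close>
  have "\<exists>g. \<forall>i. (g i \<in> verts (A (n + i)) \<and> (i = 0 \<longrightarrow> g i = c)) \<and> p (n + i) (g (Suc i)) = g i"
    by (rule dependent_nat_choice) (use c p_surj in auto)
  then obtain g where g: "\<And>i. g i \<in> verts (A (n + i))" "g 0 = c"
      "\<And>i. p (n + i) (g (Suc i)) = g i"
    by auto
  define x where "x m = (if m < n then y m else g (m - n))" for m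
  have "x m \<in> verts (A m) \<and> p m (x (Suc m)) = x m" for m
  proof (cases "m < n")
    case True
    \<comment> \<open>At the seam \<open>Suc m = n\<close> the definition switches to
      \<open>g 0\<close>, which is \<open>c\<close> and hence \<open>y n\<close>.\<close>
    then have "x (Suc m) = y (Suc m)"
      using y(1) g(2) by (cases "Suc m < n") (auto simp: x_def not_less_eq less_Suc_eq)
    then show ?thesis using True y by (simp add: x_def)
  next
    case False
    then show ?thesis using g(1)[of "m - n"] g(3)[of "m - n"]
      by (simp add: x_def Suc_diff_le)
  qed
  then show ?thesis using g(2) by (intro bexI[of _ x]) (auto simp: PLim_def x_def)
qed

section \<open>Topology of the limit and of its square\<close>

lemma continuous_proj: "continuous_map T (discrete_topology (verts (A n))) (\<lambda>x. x n)"
  unfolding PLim_topology_def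
  by (intro continuous_map_from_subtopology continuous_map_product_projection) simp

text \<open>A product of finite discrete spaces is compact, and the limit is closed in it: it is an
  intersection of sets on which two continuous maps into a Hausdorff space agree.\<close>

lemma compact_T: "compact_space T"
proof -
  let ?P = "product_topology (\<lambda>n. discrete_topology (verts (A n))) UNIV"
  have "compact_space ?P"
    using obj_graph[OF obj_A]
    by (auto simp: compact_space_product_topology compact_space_discrete_topology
        finite_reflexive_graph_def)
  moreover have "closedin ?P (PLim A p)"
  proof -
    have cont: "continuous_map ?P (discrete_topology (verts (A n))) (\<lambda>x. x n)" for n
      by (intro continuous_map_product_projection) simp
    have "continuous_map ?P (discrete_topology (verts (A n))) (\<lambda>x. p n (x (Suc n)))" for n
      using continuous_map_compose[OF cont[of "Suc n"], of "discrete_topology (verts (A n))" "p n"]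
      by (auto simp: o_def p_in)
    then have "closedin ?P {x \<in> topspace ?P. p n (x (Suc n)) = x n}" for n
      using cont by (intro closedin_continuous_maps_eq[of "discrete_topology (verts (A n))"] Hausdorff_space_discrete_topology)
    then have "closedin ?P (\<Inter>n. {x \<in> topspace ?P. p n (x (Suc n)) = x n})"
      by (intro closedin_Inter) auto
    moreover have "PLim A p = (\<Inter>n. {x \<in> topspace ?P. p n (x (Suc n)) = x n})"
      by (auto simp: PLim_def)
    ultimately show ?thesis by simp
  qed
  ultimately show ?thesis
    unfolding PLim_topology_def by (metis closedin_compact_space compact_space_subtopology)
qed

text \<open>A condition on the \<open>n\<close>-th coordinates alone is the preimage of a subset of
  a discrete space.\<close>

lemma clopen_proj:
  "openin (prod_topology T T) {(x, y). x \<in> PLim A p \<and> y \<in> PLim A p \<and> Q (x n) (y n)}"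
  "closedin (prod_topology T T) {(x, y). x \<in> PLim A p \<and> y \<in> PLim A p \<and> Q (x n) (y n)}"
proof -
  \<comment> \<open>Stated for every \<open>Q\<close>, so that its instance for the negation of
    \<open>Q\<close> gives closedness.\<close>
  have *: "openin (prod_topology T T) {(x, y). x \<in> PLim A p \<and> y \<in> PLim A p \<and> Q (x n) (y n)}" for Q
  proof -
    let ?D = "discrete_topology (verts (A n))"
    have "continuous_map (prod_topology T T) (prod_topology ?D ?D) (\<lambda>(x, y). (x n, y n))"
      by (subst continuous_map_prod_top) (simp add: continuous_proj)
    then have "openin (prod_topology T T) {z \<in> topspace (prod_topology T T).
        (\<lambda>(x, y). (x n, y n)) z \<in> {(a, b). a \<in> verts (A n) \<and> b \<in> verts (A n) \<and> Q a b}}"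
      by (rule openin_continuous_map_preimage)
         (auto simp flip: prod_topology_discrete_topology)
    also have "{z \<in> topspace (prod_topology T T).
        (\<lambda>(x, y). (x n, y n)) z \<in> {(a, b). a \<in> verts (A n) \<and> b \<in> verts (A n) \<and> Q a b}} =
        {(x, y). x \<in> PLim A p \<and> y \<in> PLim A p \<and> Q (x n) (y n)}"
      using PLim_in by auto
    finally show ?thesis .
  qed
  show "openin (prod_topology T T) {(x, y). x \<in> PLim A p \<and> y \<in> PLim A p \<and> Q (x n) (y n)}"
    by (rule *)
  have "topspace (prod_topology T T) - {(x, y). x \<in> PLim A p \<and> y \<in> PLim A p \<and> Q (x n) (y n)} =
      {(x, y). x \<in> PLim A p \<and> y \<in> PLim A p \<and> \<not> Q (x n) (y n)}"
    by auto
  then show "closedin (prod_topology T T) {(x, y). x \<in> PLim A p \<and> y \<in> PLim A p \<and> Q (x n) (y n)}"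
    using *[of "\<lambda>a b. \<not> Q a b"] by (auto simp: closedin_def)
qed

section \<open>Chains at finite levels and along threads\<close>

text \<open>These are the sets E(\<open>k\<close>, \<open>n\<close>) of the overview.\<close>

definition chain_rel :: "nat \<Rightarrow> nat \<Rightarrow> (nat \<Rightarrow> 'v) rel" where
  "chain_rel k n = {(x, y). x \<in> PLim A p \<and> y \<in> PLim A p \<and> (x n, y n) \<in> adj (A n) ^^ k}"

lemma closedin_chain_rel: "closedin (prod_topology T T) (chain_rel k n)"
  unfolding chain_rel_def
  by (rule clopen_proj(2)[where Q = "\<lambda>a b. (a, b) \<in> adj (A n) ^^ k"])

definition thread_rel :: "nat \<Rightarrow> (nat \<Rightarrow> 'v) rel" where
  "thread_rel k = (\<Inter>n. chain_rel k n)"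

lemma thread_relD:
  assumes "(x, y) \<in> thread_rel k"
  shows "x \<in> PLim A p" "y \<in> PLim A p" "(x n, y n) \<in> adj (A n) ^^ k"
  using assms by (auto simp: thread_rel_def chain_rel_def)

lemma adj_relpow_step:
  "(a, b) \<in> adj (A (Suc n)) ^^ k \<Longrightarrow> (p n a, p n b) \<in> adj (A n) ^^ k"
  by (erule relpow_map[rotated]) (rule strong_hom_adj[OF p_hom])

text \<open>Bonding maps preserve adjacency, so a chain at level \<open>Suc n\<close> projects to a
  chain of the same length at level \<open>n\<close>.\<close>

lemma decseq_chain_rel: "decseq (chain_rel k)"
proof (rule decseq_SucI)
  fix n show "chain_rel k (Suc n) \<le> chain_rel k n"
    unfolding chain_rel_def using adj_relpow_step PLim_step by fastforce
qed

lemma chain_rel_subset_open: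
  assumes "openin (prod_topology T T) U" "thread_rel k \<subseteq> U"
  shows "\<exists>n. chain_rel k n \<subseteq> U"
  using assms compact_T unfolding thread_rel_def
  by (intro compact_space_nest_subset_open[of "prod_topology T T"] decseq_chain_rel)
     (auto simp: compact_space_prod_topology closedin_chain_rel)

lemma thread_rel_0: "thread_rel 0 = Id_on (PLim A p)"
  by (auto simp: thread_rel_def chain_rel_def fun_eq_iff Id_on_iff)

text \<open>Reduces a statement about an arbitrary \<open>\<phi>\<close> to a single coordinate
  followed by a strong homomorphism.\<close>

lemma PLim_Epi_hom:
  assumes "B \<in> Obj \<K>" "\<phi> \<in> PLim_Epi \<K> A p B"
  obtains f n where "strong_hom (A n) B f" "\<And>x. x \<in> PLim A p \<Longrightarrow> \<phi> x = f (x n)"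
  using assms Epi_strong_hom[OF obj_A] by (fastforce simp: PLim_Epi_def compose_def)

text \<open>Identities are morphisms, so the coordinate projections are themselves among the maps
  that define the limit relation and the entourages.\<close>

lemma proj_Epi:
  obtains \<phi> where "\<phi> \<in> PLim_Epi \<K> A p (A n)" "\<And>x. x \<in> PLim A p \<Longrightarrow> \<phi> x = x n"
proof
  have "(\<lambda>x\<in>verts (A n). x) \<in> Epi \<K> (A n) (A n)"
    using Fraisse obj_A by (simp add: projective_Fraisse_class_def is_graph_category_def)
  then show "compose (PLim A p) (\<lambda>x\<in>verts (A n). x) (\<lambda>x. x n) \<in> PLim_Epi \<K> A p (A n)"
    unfolding PLim_Epi_def by blast
qed (simp add: compose_def PLim_in)

text \<open>Every \<open>\<phi>\<close> pushes edges forward from some \<open>A n\<close>;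
  conversely, testing against the coordinate projections recovers adjacency at each level.\<close>

lemma thread_rel_1: "thread_rel 1 = PLim_rel \<K> A p"
proof (intro subset_antisym subrelI)
  fix x y assume xy: "(x, y) \<in> thread_rel 1"
  show "(x, y) \<in> PLim_rel \<K> A p"
    unfolding PLim_rel_def
  proof (clarify, intro conjI ballI)
    fix B \<phi> assume "B \<in> Obj \<K>" "\<phi> \<in> PLim_Epi \<K> A p B"
    then obtain f n where f: "strong_hom (A n) B f" "\<And>x. x \<in> PLim A p \<Longrightarrow> \<phi> x = f (x n)"
      by (rule PLim_Epi_hom) blast
    show "(\<phi> x, \<phi> y) \<in> adj B"
      using thread_relD[OF xy] strong_hom_adj[OF f(1)] by (simp add: f(2))
  qed (use thread_relD[OF xy] in auto)
next
  fix x y assume xy: "(x, y) \<in> PLim_rel \<K> A p"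
  then have P: "x \<in> PLim A p" "y \<in> PLim A p" by (auto simp: PLim_rel_def)
  have "(x n, y n) \<in> adj (A n)" for n
  proof -
    obtain \<phi> where "\<phi> \<in> PLim_Epi \<K> A p (A n)" "\<And>x. x \<in> PLim A p \<Longrightarrow> \<phi> x = x n"
      using proj_Epi by blast
    moreover have "(\<phi> x, \<phi> y) \<in> adj (A n)"
      using xy obj_A \<open>\<phi> \<in> PLim_Epi \<K> A p (A n)\<close> unfolding PLim_rel_def by blast
    ultimately show ?thesis using P by simp
  qed
  then show "(x, y) \<in> thread_rel 1" using P by (simp add: thread_rel_def chain_rel_def)
qed

text \<open>The threads that can serve as last intermediate point at level \<open>n\<close> form a
  nonempty closed set \<open>C n\<close>, decreasing in \<open>n\<close>. By compactness one thread
  serves at all levels.\<close>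

lemma thread_rel_Suc: "thread_rel (Suc k) \<subseteq> thread_rel k O thread_rel 1"
proof (rule subrelI)
  fix x y assume xy: "(x, y) \<in> thread_rel (Suc k)"
  note x = thread_relD(1)[OF xy] and y = thread_relD(2)[OF xy]
  define C where "C n = {z \<in> PLim A p. (x n, z n) \<in> adj (A n) ^^ k \<and> (z n, y n) \<in> adj (A n)}" for n
  have "(\<Inter>n. C n) \<noteq> {}"
  proof (rule compact_space_imp_nest[OF compact_T])
    fix n
    have "closedin T {z \<in> topspace T. z n \<in> {a \<in> verts (A n). (x n, a) \<in> adj (A n) ^^ k \<and> (a, y n) \<in> adj (A n)}}"
      by (rule closedin_continuous_map_preimage[OF continuous_proj]) auto
    also have "{z \<in> topspace T. z n \<in> {a \<in> verts (A n). (x n, a) \<in> adj (A n) ^^ k \<and> (a, y n) \<in> adj (A n)}} = C n"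
      using PLim_in by (auto simp: C_def)
    finally show "closedin T (C n)" .
    \<comment> \<open>Here \<open>c\<close> is the last vertex but one of the chain in
      \<open>A n\<close>; any thread through \<open>c\<close> lies in \<open>C n\<close>.\<close>
    obtain c where c: "(x n, c) \<in> adj (A n) ^^ k" "(c, y n) \<in> adj (A n)"
      using thread_relD(3)[OF xy, of n] by auto
    then obtain z where "z \<in> PLim A p" "z n = c"
      using proj_surj adj_verts[OF obj_A c(2)] by blast
    then show "C n \<noteq> {}" using c by (auto simp: C_def)
  next
    show "decseq C"
    proof (rule decseq_SucI)
      fix n show "C (Suc n) \<le> C n"
      proof
        fix z assume z: "z \<in> C (Suc n)"
        then have "(p n (x (Suc n)), p n (z (Suc n))) \<in> adj (A n) ^^ k"
            "(p n (z (Suc n)), p n (y (Suc n))) \<in> adj (A n)"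
          using adj_relpow_step strong_hom_adj[OF p_hom] by (auto simp: C_def)
        then show "z \<in> C n" using z x y by (simp add: C_def PLim_step)
      qed
    qed
  qed
  then obtain z where "\<And>n. z \<in> C n" by blast
  then have "(x, z) \<in> thread_rel k" "(z, y) \<in> thread_rel 1"
    using x y by (auto simp: C_def thread_rel_def chain_rel_def)
  then show "(x, y) \<in> thread_rel k O thread_rel 1" by blast
qed

text \<open>An edge becomes a chain of length \<open>k\<close> by first repeating the loop at its
  initial vertex.\<close>

lemma chain_rel_mono:
  assumes "1 \<le> k" shows "chain_rel 1 n \<subseteq> chain_rel k n"
proof (rule subrelI)
  fix x y assume xy: "(x, y) \<in> chain_rel 1 n"
  obtain j where k: "k = Suc j" using assms by (cases k) auto
  have "(x n, x n) \<in> adj (A n) ^^ j"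
    using xy by (intro refl_on_relpow adj_refl obj_A) (auto simp: chain_rel_def PLim_in)
  then show "(x, y) \<in> chain_rel k n"
    using xy by (auto simp: chain_rel_def k)
qed

text \<open>For one inclusion, edges are split off one at a time and transitivity absorbs each of
  them; for the other, a single edge is padded with loops at every level.\<close>

lemma thread_rel_pos:
  assumes "1 \<le> k" shows "thread_rel k = PLim_rel \<K> A p"
proof
  show "thread_rel k \<subseteq> PLim_rel \<K> A p"
    using assms
  proof (induction k rule: dec_induct)
    case base
    then show ?case by (simp add: thread_rel_1[simplified])
  next
    case (step k)
    then have "thread_rel (Suc k) \<subseteq> PLim_rel \<K> A p O PLim_rel \<K> A p"
      using thread_rel_Suc[of k] thread_rel_1 by blast
    then show ?case using trans_O_subset[OF transitive] by blast
  qed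
  show "PLim_rel \<K> A p \<subseteq> thread_rel k"
    unfolding thread_rel_1[symmetric] using chain_rel_mono[OF assms]
    by (auto simp: thread_rel_def)
qed

text \<open>Lets concatenated chains of length \<open>k\<close> be controlled by the same limit set;
  the composition axiom rests on this.\<close>

lemma thread_rel_double: "thread_rel (k + k) = thread_rel k"
  by (cases "k = 0") (simp_all add: thread_rel_pos)

text \<open>Since \<open>\<phi>\<close> factors through one coordinate, \<open>U\<close> is a
  condition on that coordinate, and the strong homomorphism carries chains in \<open>A n\<close> to
  chains in \<open>B\<close>.\<close>

lemma Epi_rel_open:
  fixes k :: nat
  assumes "B \<in> Obj \<K>" "\<phi> \<in> PLim_Epi \<K> A p B"
  defines "U \<equiv> {(x, y). x \<in> PLim A p \<and> y \<in> PLim A p \<and> (\<phi> x, \<phi> y) \<in> adj B ^^ k}"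
  shows "openin (prod_topology T T) U" "thread_rel k \<subseteq> U"
proof -
  obtain f n where f: "strong_hom (A n) B f" "\<And>x. x \<in> PLim A p \<Longrightarrow> \<phi> x = f (x n)"
    using assms(1,2) by (rule PLim_Epi_hom) blast
  have U: "U = {(x, y). x \<in> PLim A p \<and> y \<in> PLim A p \<and> (f (x n), f (y n)) \<in> adj B ^^ k}"
    unfolding U_def using f(2) by auto
  show "openin (prod_topology T T) U"
    unfolding U by (rule clopen_proj(1)[where Q = "\<lambda>a b. (f a, f b) \<in> adj B ^^ k"])
  show "thread_rel k \<subseteq> U"
  proof (rule subrelI)
    fix x y assume xy: "(x, y) \<in> thread_rel k"
    have "(f (x n), f (y n)) \<in> adj B ^^ k"
      using thread_relD(3)[OF xy, of n] by (rule relpow_map[rotated]) (rule strong_hom_adj[OF f(1)])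
    then show "(x, y) \<in> U" using thread_relD[OF xy] by (simp add: U)
  qed
qed

section \<open>Entourages of automorphisms and the uniformity axioms\<close>

lemma Aut_in: "\<sigma> \<in> Aut \<K> A p \<Longrightarrow> x \<in> PLim A p \<Longrightarrow> \<sigma> x \<in> PLim A p"
  using homeomorphic_imp_surjective_map[of T T \<sigma>] by (auto simp: Aut_def)

text \<open>This is the basic entourage of the projection to \<open>A n\<close>, phrased through
  \<open>chain_rel\<close> so that inclusions between relations on the limit apply
  pointwise.\<close>

definition chain_entourage :: "nat \<Rightarrow> nat \<Rightarrow> ((nat \<Rightarrow> 'v) \<Rightarrow> (nat \<Rightarrow> 'v)) rel" where
  "chain_entourage k n = {(f, g). f \<in> Aut \<K> A p \<and> g \<in> Aut \<K> A p \<and>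
     (\<forall>x\<in>PLim A p. (f x, g x) \<in> chain_rel k n)}"

lemma chain_entourage_in: "chain_entourage k n \<in> Aut_uniformity \<K> A p k"
proof -
  obtain \<phi> where \<phi>: "\<phi> \<in> PLim_Epi \<K> A p (A n)" "\<And>x. x \<in> PLim A p \<Longrightarrow> \<phi> x = x n"
    using proj_Epi by blast
  have "entourage \<K> A p k (A n) \<phi> \<subseteq> chain_entourage k n"
    by (auto simp: entourage_def chain_entourage_def chain_rel_def Aut_in \<phi>(2))
  then show ?thesis
    unfolding Aut_uniformity_def using \<phi>(1) obj_A by (auto simp: chain_entourage_def)
qed

lemma Aut_uniformity_supset:
  "U \<in> Aut_uniformity \<K> A p k \<Longrightarrow> U \<subseteq> W \<Longrightarrow> W \<subseteq> Aut \<K> A p \<times> Aut \<K> A p \<Longrightarrow>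
    W \<in> Aut_uniformity \<K> A p k"
  unfolding Aut_uniformity_def by blast

lemma is_uniformity_Aut: "is_uniformity (Aut \<K> A p) (Aut_uniformity \<K> A p k)"
  unfolding is_uniformity_def
proof (intro conjI ballI allI impI)
  fix V assume V: "V \<in> Aut_uniformity \<K> A p k"
  then obtain B \<phi> where B: "B \<in> Obj \<K>" "\<phi> \<in> PLim_Epi \<K> A p B" "entourage \<K> A p k B \<phi> \<subseteq> V"
    by (auto simp: Aut_uniformity_def)
  show VA: "V \<subseteq> Aut \<K> A p \<times> Aut \<K> A p"
    using V by (simp add: Aut_uniformity_def)
  obtain f n where f: "strong_hom (A n) B f" "\<And>x. x \<in> PLim A p \<Longrightarrow> \<phi> x = f (x n)"
    using B(1,2) by (rule PLim_Epi_hom) blast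
  have "\<phi> x \<in> verts B" if "x \<in> PLim A p" for x
    using f that PLim_in by (auto simp: strong_hom_def)
  then have "Id_on (Aut \<K> A p) \<subseteq> entourage \<K> A p k B \<phi>"
    using refl_on_relpow[OF adj_refl[OF B(1)]] by (auto simp: entourage_def Aut_in)
  then show "Id_on (Aut \<K> A p) \<subseteq> V" using B(3) by blast
  have "sym (adj B ^^ k)"
    using obj_graph[OF B(1)] by (intro sym_relpow) (simp add: finite_reflexive_graph_def)
  then have "(entourage \<K> A p k B \<phi>)\<inverse> = entourage \<K> A p k B \<phi>"
    by (auto simp: entourage_def dest: symD)
  then have "entourage \<K> A p k B \<phi> \<subseteq> V\<inverse>"
    using B(3) converse_mono by metis
  then show "V\<inverse> \<in> Aut_uniformity \<K> A p k"
    using B VA by (auto simp: Aut_uniformity_def)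
  \<comment> \<open>Composition axiom: \<open>?U\<close> is open and contains
    \<open>thread_rel k\<close>, which equals \<open>thread_rel (k + k)\<close>, so at some level
    all chains of length \<open>k + k\<close> already land in \<open>?U\<close>.\<close>
  let ?U = "{(x, y). x \<in> PLim A p \<and> y \<in> PLim A p \<and> (\<phi> x, \<phi> y) \<in> adj B ^^ k}"
  have "\<exists>n. chain_rel (k + k) n \<subseteq> ?U"
    by (rule chain_rel_subset_open)
       (simp_all only: thread_rel_double Epi_rel_open[OF B(1,2)])
  then obtain n where n: "chain_rel (k + k) n \<subseteq> ?U" ..
  have "chain_entourage k n O chain_entourage k n \<subseteq> entourage \<K> A p k B \<phi>"
  proof (clarify)
    fix f g h assume fg: "(f, g) \<in> chain_entourage k n" and gh: "(g, h) \<in> chain_entourage k n"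
    have "(f x, h x) \<in> chain_rel (k + k) n" if "x \<in> PLim A p" for x
    proof -
      have "(f x, g x) \<in> chain_rel k n" "(g x, h x) \<in> chain_rel k n"
        using fg gh that by (simp_all add: chain_entourage_def)
      then show ?thesis
        unfolding chain_rel_def using relpow_trans by fast
    qed
    then show "(f, h) \<in> entourage \<K> A p k B \<phi>"
      using fg gh n unfolding chain_entourage_def entourage_def by blast
  qed
  then show "\<exists>U\<in>Aut_uniformity \<K> A p k. U O U \<subseteq> V"
    using chain_entourage_in B(3) by blast
next
  fix U W assume "U \<in> Aut_uniformity \<K> A p k" "U \<subseteq> W \<and> W \<subseteq> Aut \<K> A p \<times> Aut \<K> A p"
  then show "W \<in> Aut_uniformity \<K> A p k"
    using Aut_uniformity_supset by blast
qed

section \<open>Comparison with the uniformities induced by metrics\<close>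

text \<open>Sublevel sets of \<open>\<delta>\<close> and the sets \<open>chain_rel k n\<close> both
  shrink to \<open>thread_rel k\<close>. By compactness each family eventually enters any open set
  around it, and evaluating automorphisms pointwise transfers this to entourages.\<close>

lemma Aut_uniformity_eq_induced:
  assumes cont: "continuous_map (prod_topology T T) euclideanreal (\<lambda>(x, y). \<delta> x y)"
    and zero: "\<And>x y. x \<in> PLim A p \<Longrightarrow> y \<in> PLim A p \<Longrightarrow> \<delta> x y = 0 \<longleftrightarrow> (x, y) \<in> thread_rel k"
    and nonneg: "\<And>x y. x \<in> PLim A p \<Longrightarrow> y \<in> PLim A p \<Longrightarrow> 0 \<le> \<delta> x y"
  shows "Aut_uniformity \<K> A p k = induced_uniformity (Aut \<K> A p) (sup_dist (PLim A p) \<delta>)"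
proof (intro set_eqI iffI)
  have compact: "compact_space (prod_topology T T)"
    using compact_T by (simp add: compact_space_prod_topology)
  fix W
  {
    assume W: "W \<in> Aut_uniformity \<K> A p k"
    then obtain B \<phi> where B: "B \<in> Obj \<K>" "\<phi> \<in> PLim_Epi \<K> A p B" "entourage \<K> A p k B \<phi> \<subseteq> W"
      by (auto simp: Aut_uniformity_def)
    let ?U = "{(x, y). x \<in> PLim A p \<and> y \<in> PLim A p \<and> (\<phi> x, \<phi> y) \<in> adj B ^^ k}"
    \<comment> \<open>Non-strict inequalities make the sublevel sets closed, as the nesting argument
      demands.\<close>
    define C where
      "C n = {(x, y). x \<in> PLim A p \<and> y \<in> PLim A p \<and> \<delta> x y \<le> 1 / real (Suc n)}" for n
    have "\<exists>n. C n \<subseteq> ?U"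
    proof (rule compact_space_nest_subset_open[OF compact])
      fix n
      have "closedin (prod_topology T T)
          {z \<in> topspace (prod_topology T T). (\<lambda>(x, y). \<delta> x y) z \<in> {..1 / real (Suc n)}}"
        by (rule closedin_continuous_map_preimage[OF cont]) auto
      also have "{z \<in> topspace (prod_topology T T). (\<lambda>(x, y). \<delta> x y) z \<in> {..1 / real (Suc n)}} = C n"
        by (auto simp: C_def)
      finally show "closedin (prod_topology T T) (C n)" .
    next
      show "decseq C"
      proof (rule decseq_SucI)
        fix n
        have "1 / real (Suc (Suc n)) \<le> 1 / real (Suc n)" by (simp add: frac_le)
        then show "C (Suc n) \<le> C n" unfolding C_def by fastforce
      qed
      show "openin (prod_topology T T) ?U" by (rule Epi_rel_open(1)[OF B(1,2)])
      have "(\<Inter>n. C n) \<subseteq> thread_rel k"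
      proof (rule subrelI)
        fix x y assume "(x, y) \<in> (\<Inter>n. C n)"
        then have P: "x \<in> PLim A p" "y \<in> PLim A p" and le: "\<And>n. \<delta> x y \<le> 1 / real (Suc n)"
          by (auto simp: C_def)
        have "\<not> 0 < \<delta> x y"
          using le nat_approx_posE[of "\<delta> x y"] by (meson not_less)
        then show "(x, y) \<in> thread_rel k" using nonneg[OF P] zero[OF P] by linarith
      qed
      then show "(\<Inter>n. C n) \<subseteq> ?U" using Epi_rel_open(2)[OF B(1,2)] by blast
    qed
    then obtain n where n: "C n \<subseteq> ?U" by blast
    \<comment> \<open>Boundedness of \<open>\<delta>\<close> on the compact square ensures that the
      supremum really bounds each pointwise value.\<close>
    have "compact ((\<lambda>(x, y). \<delta> x y) ` (PLim A p \<times> PLim A p))"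
      using image_compactin[OF _ cont] compact unfolding compact_space_def
      by (metis compactin_euclidean_iff topspace_prod_topology topspace_Lim_topology)
    then have bdd: "bdd_above ((\<lambda>(x, y). \<delta> x y) ` (PLim A p \<times> PLim A p))"
      by (intro bounded_imp_bdd_above compact_imp_bounded)
    have "{(\<sigma>, \<tau>). \<sigma> \<in> Aut \<K> A p \<and> \<tau> \<in> Aut \<K> A p \<and>
        sup_dist (PLim A p) \<delta> \<sigma> \<tau> < 1 / real (Suc n)} \<subseteq> entourage \<K> A p k B \<phi>"
    proof clarify
      fix \<sigma> \<tau> assume \<sigma>: "\<sigma> \<in> Aut \<K> A p" and \<tau>: "\<tau> \<in> Aut \<K> A p"
        and lt: "sup_dist (PLim A p) \<delta> \<sigma> \<tau> < 1 / real (Suc n)"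
      have "(\<phi> (\<sigma> x), \<phi> (\<tau> x)) \<in> adj B ^^ k" if x: "x \<in> PLim A p" for x
      proof -
        have "bdd_above ((\<lambda>x. \<delta> (\<sigma> x) (\<tau> x)) ` PLim A p)"
          using bdd by (rule bdd_above_mono) (use Aut_in \<sigma> \<tau> in auto)
        then have "\<delta> (\<sigma> x) (\<tau> x) \<le> sup_dist (PLim A p) \<delta> \<sigma> \<tau>"
          using x by (auto simp: sup_dist_def intro: cSUP_upper2)
        then have "(\<sigma> x, \<tau> x) \<in> C n"
          using lt x \<sigma> \<tau> by (auto simp: C_def Aut_in)
        then show ?thesis using n by blast
      qed
      then show "(\<sigma>, \<tau>) \<in> entourage \<K> A p k B \<phi>" using \<sigma> \<tau> by (simp add: entourage_def)
    qed
    then show "W \<in> induced_uniformity (Aut \<K> A p) (sup_dist (PLim A p) \<delta>)"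
      using W B(3) unfolding induced_uniformity_def Aut_uniformity_def
      by (auto intro!: exI[of _ "1 / real (Suc n)"])
  }
  {
    assume "W \<in> induced_uniformity (Aut \<K> A p) (sup_dist (PLim A p) \<delta>)"
    then obtain r where r: "0 < r" and W: "W \<subseteq> Aut \<K> A p \<times> Aut \<K> A p"
      and sub: "{(x, y). x \<in> Aut \<K> A p \<and> y \<in> Aut \<K> A p \<and> sup_dist (PLim A p) \<delta> x y < r} \<subseteq> W"
      by (auto simp: induced_uniformity_def)
    \<comment> \<open>A pointwise strict bound yields only a non-strict bound for the supremum;
      halving \<open>r\<close> restores strictness.\<close>
    let ?U = "{z \<in> topspace (prod_topology T T). (\<lambda>(x, y). \<delta> x y) z \<in> {..<r / 2}}"
    have "openin (prod_topology T T) ?U"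
      by (rule openin_continuous_map_preimage[OF cont]) auto
    moreover have "thread_rel k \<subseteq> ?U"
    proof (rule subrelI)
      fix x y assume xy: "(x, y) \<in> thread_rel k"
      then show "(x, y) \<in> ?U" using thread_relD(1,2)[OF xy] zero[of x y] r by simp
    qed
    ultimately obtain n where n: "chain_rel k n \<subseteq> ?U"
      using chain_rel_subset_open by blast
    have "chain_entourage k n \<subseteq> W"
    proof (rule subrelI)
      fix \<sigma> \<tau> assume st: "(\<sigma>, \<tau>) \<in> chain_entourage k n"
      have "\<delta> (\<sigma> x) (\<tau> x) \<le> r / 2" if "x \<in> PLim A p" for x
        using st that n by (fastforce simp: chain_entourage_def)
      \<comment> \<open>For an empty limit \<open>sup_dist\<close> takes its default value
        0.\<close>
      then have "sup_dist (PLim A p) \<delta> \<sigma> \<tau> \<le> r / 2"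
        using r by (cases "PLim A p = {}") (simp_all add: sup_dist_def cSUP_least del: le_divide_eq_numeral1)
      then show "(\<sigma>, \<tau>) \<in> W"
        using sub r st by (auto simp: chain_entourage_def)
    qed
    then show "W \<in> Aut_uniformity \<K> A p k"
      using Aut_uniformity_supset[OF chain_entourage_in] W by blast
  }
qed

text \<open>A metric vanishes exactly on the diagonal, which is \<open>thread_rel 0\<close>.\<close>

lemma Aut_uniformity_limit:
  assumes "compatible_metric T \<rho>"
  shows "Aut_uniformity \<K> A p 0 = induced_uniformity (Aut \<K> A p) (sup_dist (PLim A p) \<rho>)"
proof (rule Aut_uniformity_eq_induced)
  interpret Metric_space "PLim A p" \<rho>
    using assms by (simp add: compatible_metric_def)
  have T: "mtopology = T" using assms by (simp add: compatible_metric_def)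
  have "continuous_map (prod_topology T T) euclideanreal (\<lambda>z. \<rho> (fst z) (snd z))"
    using continuous_map_mdist[of "prod_topology T T" "metric (PLim A p, \<rho>)" fst snd]
    by (simp add: T continuous_map_fst continuous_map_snd)
  then show "continuous_map (prod_topology T T) euclideanreal (\<lambda>(x, y). \<rho> x y)"
    by (simp add: case_prod_unfold)
  show "\<rho> x y = 0 \<longleftrightarrow> (x, y) \<in> thread_rel 0" if "x \<in> PLim A p" "y \<in> PLim A p" for x y
    using that by (auto simp: thread_rel_0)
qed (use assms in \<open>auto simp: compatible_metric_def Metric_space_def\<close>)

text \<open>The pullback of \<open>d\<close> along the quotient map vanishes exactly on pairs with
  equal classes, that is on \<open>thread_rel k\<close> for positive \<open>k\<close>.\<close>

lemma Aut_uniformity_quotient: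
  assumes d: "compatible_metric (quot_topology \<K> A p) d" and k: "1 \<le> k"
  shows "Aut_uniformity \<K> A p k = induced_uniformity (Aut \<K> A p)
    (\<lambda>\<sigma> \<tau>. sup_dist (quot \<K> A p) d (pr_hom \<K> A p \<sigma>) (pr_hom \<K> A p \<tau>))"
proof -
  let ?\<delta> = "\<lambda>x y. d (pr \<K> A p x) (pr \<K> A p y)"
  interpret Metric_space "quot \<K> A p" d
    using d by (simp add: compatible_metric_def)
  have Q: "mtopology = quot_topology \<K> A p" using d by (simp add: compatible_metric_def)
  have pr_cont: "continuous_map T mtopology (pr \<K> A p)"
    unfolding Q by (intro quotient_imp_continuous_map quotient_map_pr)
  have im: "quot \<K> A p = pr \<K> A p ` PLim A p"
    unfolding quot_def pr_def quotient_def by blast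
  have "Aut_uniformity \<K> A p k = induced_uniformity (Aut \<K> A p) (sup_dist (PLim A p) ?\<delta>)"
  proof (rule Aut_uniformity_eq_induced)
    have "continuous_map (prod_topology T T) euclideanreal (\<lambda>z. ?\<delta> (fst z) (snd z))"
      using continuous_map_mdist[of "prod_topology T T" "metric (quot \<K> A p, d)"
          "pr \<K> A p \<circ> fst" "pr \<K> A p \<circ> snd"]
        continuous_map_compose[OF continuous_map_fst[of T T] pr_cont]
        continuous_map_compose[OF continuous_map_snd[of T T] pr_cont] by simp
    then show "continuous_map (prod_topology T T) euclideanreal (\<lambda>(x, y). ?\<delta> x y)"
      by (simp add: case_prod_unfold)
    fix x y assume P: "x \<in> PLim A p" "y \<in> PLim A p"
    have "?\<delta> x y = 0 \<longleftrightarrow> pr \<K> A p x = pr \<K> A p y"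
      using P by (auto simp: im)
    also have "\<dots> \<longleftrightarrow> (x, y) \<in> PLim_rel \<K> A p"
      using eq_equiv_class_iff[OF equiv_PLim_rel[OF Fraisse generic transitive] P] by (simp add: pr_def)
    finally show "?\<delta> x y = 0 \<longleftrightarrow> (x, y) \<in> thread_rel k"
      using k by (simp add: thread_rel_pos)
  qed simp
  also have "\<dots> = induced_uniformity (Aut \<K> A p)
    (\<lambda>\<sigma> \<tau>. sup_dist (quot \<K> A p) d (pr_hom \<K> A p \<sigma>) (pr_hom \<K> A p \<tau>))"
  proof -
    have "sup_dist (quot \<K> A p) d (pr_hom \<K> A p \<sigma>) (pr_hom \<K> A p \<tau>) = sup_dist (PLim A p) ?\<delta> \<sigma> \<tau>"
      if "\<sigma> \<in> Aut \<K> A p" "\<tau> \<in> Aut \<K> A p" for \<sigma> \<tau>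
    proof -
      \<comment> \<open>Every class is \<open>pr \<K> A p x\<close> for some thread
        \<open>x\<close>, and \<open>pr_hom_pr\<close> rewrites the values there; equal sets of
        values have equal suprema.\<close>
      have "(\<lambda>c. d (pr_hom \<K> A p \<sigma> c) (pr_hom \<K> A p \<tau> c)) ` quot \<K> A p =
          (\<lambda>x. ?\<delta> (\<sigma> x) (\<tau> x)) ` PLim A p"
        unfolding im image_image using that
        by (intro image_cong) (simp_all add: pr_hom_pr[OF Fraisse generic transitive])
      then show ?thesis by (simp add: sup_dist_def im)
    qed
    then show ?thesis
      unfolding induced_uniformity_def by (simp cong: conj_cong)
  qed
  finally show ?thesis .
qed

end

theorem theorem2p3:
  fixes \<K> :: "'v graph_category"
    and A :: "nat \<Rightarrow> 'v rgraph"
    and p :: "nat \<Rightarrow> 'v \<Rightarrow> 'v"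
  assumes "projective_Fraisse_class \<K>"
    and "generic_sequence \<K> A p"
    and "trans (PLim_rel \<K> A p)"
  shows "(\<forall>k. is_uniformity (Aut \<K> A p) (Aut_uniformity \<K> A p k)) \<and>
    (\<forall>\<rho>. compatible_metric (PLim_topology A p) \<rho> \<longrightarrow>
      Aut_uniformity \<K> A p 0 = induced_uniformity (Aut \<K> A p) (sup_dist (PLim A p) \<rho>)) \<and>
    (\<forall>d\<^sub>0. compatible_metric (quot_topology \<K> A p) d\<^sub>0 \<longrightarrow>
      (\<forall>k\<ge>1. Aut_uniformity \<K> A p k =
        induced_uniformity (Aut \<K> A p)
          (\<lambda>\<sigma> \<tau>. sup_dist (quot \<K> A p) d\<^sub>0 (pr_hom \<K> A p \<sigma>) (pr_hom \<K> A p \<tau>))))"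
proof -
  interpret transitive_limit \<K> A p using assms by unfold_locales
  show ?thesis
    using is_uniformity_Aut Aut_uniformity_limit Aut_uniformity_quotient by blast
qed

end
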